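(* Let $y(t)\equiv y(t,\xi,\eta,\phi)$ denote the solution of the local problem $$\dot y(t)=f(y(t),\phi),\quad t\in[\xi,T],\qquad y(\xi)=\eta ,$$ where $\xi\in[0,1)$, $T\in(\xi,1)$, $\eta,\phi\in\mathbb{R}^m$ and $f:\mathbb{R}^m\times\mathbb{R}^m\to\mathbb{R}^m$ is $C^\infty$. Then, for $t\in[\xi,T]$: a) $\displaystyle \frac{\partial}{\partial t}y(t)=f(y(t),\phi)$; b) $\displaystyle \frac{\partial}{\partial\eta}y(t)=\Phi(t,\xi,\eta,\phi,y)$; c) $\displaystyle \frac{\partial}{\partial\xi}y(t)=-\Phi(t,\xi,\eta,\phi,y)\,f(\eta,\phi)$; where $\Phi(t,\xi,\eta,\phi,y)\in\mathbb{R}^{m\times m}$ is the solution of the variational problem $$\dot\Phi(t,\xi,\eta,\phi,y)=F_1(y(t),\phi)\,\Phi(t,\xi,\eta,\phi,y),\quad t\in[\xi,T],\qquad \Phi(\xi,\xi,\eta,\phi,y)=I_m .$$ Further, d) $\displaystyle \frac{\partial}{\partial\phi}y(t)=\int_\xi^t\Phi(t,s,\eta,\phi,y)\,F_2(y(s),\phi)\,ds .$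
   Context: The vector $\phi\in\mathbb{R}^m$ is a constant (memory) parameter. $F_1(z,w)=\frac{\partial}{\partial z}f(z,w)$ and $F_2(z,w)=\frac{\partial}{\partial w}f(z,w)$ denote the Jacobian matrices of $f$ with respect to its first and second argument. The dot denotes the derivative with respect to $t$; $I_m$ is the $m\times m$ identity matrix. The solution $y(\cdot,\xi,\eta,\phi)$ is assumed to exist on $[\xi,T]$. For $s\in[\xi,T]$, $\Phi(t,s,\eta,\phi,y)$ denotes the solution, as a function of $t$, of $\dot\Phi=F_1(y(t),\phi)\Phi$ with $\Phi(s,s,\eta,\phi,y)=I_m$, along the same trajectory $y(\cdot)=y(\cdot,\xi,\eta,\phi)$ (so $\Phi(t,s)=W(t)W(s)^{-1}$ for any nonsingular matrix solution $W$ of $\dot W=F_1(y(t),\phi)W$). Derivatives with respect to $\eta$, $\phi$ are Jacobian matrices. *)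

theory Defs
  imports "HOL-Analysis.Analysis"
begin

text \<open>
  On an open set, here the whole Euclidean space, the iterated directional derivatives
  up to order \<open>k\<close> exist and are continuous iff the function is \<open>C^k\<close> in the usual sense.
\<close>

primrec Ck :: "nat \<Rightarrow> ('a::euclidean_space \<Rightarrow> 'b::real_normed_vector) \<Rightarrow> bool" where
  "Ck 0 f \<longleftrightarrow> continuous_on UNIV f"
| "Ck (Suc k) f \<longleftrightarrow>
     (\<forall>x. f differentiable (at x)) \<and> (\<forall>v. Ck k (\<lambda>x. frechet_derivative f (at x) v))"

definition C_infinity :: "('a::euclidean_space \<Rightarrow> 'b::real_normed_vector) \<Rightarrow> bool" where
  "C_infinity f \<longleftrightarrow> (\<forall>k. Ck k f)"

text \<open>
  The derivative is taken within \<open>S\<close>, hence it is one-sided at end points of an interval.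
\<close>

definition solves_ivp ::
    "(real \<Rightarrow> 'a \<Rightarrow> 'a) \<Rightarrow> real \<Rightarrow> 'a \<Rightarrow> real set \<Rightarrow> (real \<Rightarrow> 'a::real_normed_vector) \<Rightarrow> bool" where
  "solves_ivp g t0 x0 S x \<longleftrightarrow>
     x t0 = x0 \<and> (\<forall>t\<in>S. (x has_vector_derivative g t (x t)) (at t within S))"

text \<open>
  The value at time \<open>t\<close> of the solution through \<open>(t0, x0)\<close>. The segment between
  \<open>t0\<close> and \<open>t\<close> is used so that \<open>t\<close> may lie on either side of \<open>t0\<close>. The value is
  meaningful only if a solution exists up to time \<open>t\<close> and is unique there.
\<close>

definition ivp_value ::
    "(real \<Rightarrow> 'a \<Rightarrow> 'a) \<Rightarrow> real \<Rightarrow> 'a \<Rightarrow> real \<Rightarrow> 'a::real_normed_vector" where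
  "ivp_value g t0 x0 t =
     (THE v. \<exists>x. solves_ivp g t0 x0 (closed_segment t0 t) x \<and> x t = v)"

definition F1 :: "(real^'m \<Rightarrow> real^'m \<Rightarrow> real^'m) \<Rightarrow> real^'m \<Rightarrow> real^'m \<Rightarrow> real^'m^'m" where
  "F1 f z w = jacobian (\<lambda>z'. f z' w) (at z)"

definition F2 :: "(real^'m \<Rightarrow> real^'m \<Rightarrow> real^'m) \<Rightarrow> real^'m \<Rightarrow> real^'m \<Rightarrow> real^'m^'m" where
  "F2 f z w = jacobian (\<lambda>w'. f z w') (at w)"

definition local_sol ::
    "(real^'m \<Rightarrow> real^'m \<Rightarrow> real^'m) \<Rightarrow> real \<Rightarrow> real \<Rightarrow> real^'m \<Rightarrow> real^'m \<Rightarrow> real^'m" where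
  "local_sol f t \<xi> \<eta> \<phi> = ivp_value (\<lambda>_ x. f x \<phi>) \<xi> \<eta> t"

definition variational_rhs ::
    "(real^'m \<Rightarrow> real^'m \<Rightarrow> real^'m) \<Rightarrow> real^'m \<Rightarrow> (real \<Rightarrow> real^'m) \<Rightarrow>
      real \<Rightarrow> real^'m^'m \<Rightarrow> real^'m^'m" where
  "variational_rhs f \<phi> y t M = F1 f (y t) \<phi> ** M"

definition Phi ::
    "(real^'m \<Rightarrow> real^'m \<Rightarrow> real^'m) \<Rightarrow> real \<Rightarrow> real \<Rightarrow> real^'m \<Rightarrow> (real \<Rightarrow> real^'m) \<Rightarrow> real^'m^'m" where
  "Phi f t s \<phi> y = ivp_value (variational_rhs f \<phi> y) s (mat 1) t"

end

theory Submission
  imports Defs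
begin

text \<open>
  Everything about the solution \<open>u\<close> through \<open>(\<xi>, \<eta>)\<close> is read off from the linear equation
  \<open>v' = F1 f (u t) \<phi> *v v\<close> along it. Its fundamental matrix \<open>W\<close>, with \<open>W \<xi>\<close> the identity, has a
  continuous inverse \<open>V\<close> (\<open>fundamental_matrix\<close>), and \<open>\<Phi> t s = W t ** V s\<close>.

  The derivatives in \<open>\<eta>\<close> and \<open>\<phi>\<close> come from one statement. If the initial value is moved by \<open>h\<close> and
  the parameter by \<open>k\<close>, the solution moves to first order by the solution \<open>v\<close> of
  \<open>v' = F1 v + F2 k\<close>, \<open>v \<xi> = h\<close> (\<open>local_sol_has_joint_derivative\<close>). Variation of constants gives
  \<open>v t = W t *v h + (W t ** integral {\<xi>..t} (\<lambda>s. V s ** F2 ...)) *v k\<close>, and both formulas are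
  visible. With the parameter adjoined to the state, this is differentiability of the flow of an
  autonomous \<open>C\<^sup>1\<close> system in its initial value (\<open>flow_has_derivative\<close>): the error of the linear
  prediction solves a linear equation whose forcing is the Taylor remainder, and Gronwall's inequality
  (\<open>growth_estimate\<close>) bounds it.

  The derivative in \<open>\<xi>\<close> needs only time translation: the value at \<open>t\<close> of the solution started at \<open>\<xi>'\<close>
  is that of \<open>u\<close> at \<open>t + \<xi> - \<xi>'\<close>, so the derivative is \<open>- f (u t) \<phi>\<close>
  (\<open>local_sol_has_start_derivative\<close>). As a function of \<open>t\<close>, \<open>f (u t) \<phi>\<close> solves the linear equation
  with initial value \<open>f \<eta> \<phi>\<close>, so it equals \<open>W t *v f \<eta> \<phi>\<close>.

  These arguments presuppose that nearby solutions exist on the whole interval, that \<open>u\<close> continues a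
  little beyond it, and that solutions are unique, because the values are definite descriptions.
  Uniqueness is again Gronwall's inequality. For existence, \<open>f\<close> is cut off outside a ball around the
  trajectory to become globally Lipschitz, Picard-Lindelof then provides solutions on intervals of any
  length (\<open>lipschitz_ivp_solvable\<close>), and the solutions of interest do not leave the ball.
\<close>

section \<open>Growth estimate and uniqueness\<close>

text \<open>
  Gronwall's inequality in differential form. The norm itself need not be differentiable where
  \<open>e\<close> vanishes, so the proof works with the regularised norm \<open>sqrt (e \<bullet> e + \<delta>\<^sup>2)\<close>, whose derivative
  is at most \<open>L\<close> times itself plus \<open>\<epsilon>\<close> by the Cauchy-Schwarz inequality; \<open>\<delta>\<close> then tends to zero.
\<close>

lemma growth_estimate:
  fixes e :: "real \<Rightarrow> 'a::real_inner"
  assumes deriv: "\<And>t. t \<in> {a..b} \<Longrightarrow> (e has_vector_derivative e' t) (at t within {a..b})"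
    and bound: "\<And>t. t \<in> {a..b} \<Longrightarrow> norm (e' t) \<le> L * norm (e t) + \<epsilon>"
    and nonneg: "0 \<le> L" "0 \<le> \<epsilon>"
    and t: "t \<in> {a..b}"
  shows "norm (e t) \<le> exp (L * (t - a)) * (norm (e a) + \<epsilon> * (t - a))"
proof (rule field_le_epsilon)
  fix \<gamma> :: real assume "0 < \<gamma>"
  define \<delta> where "\<delta> = \<gamma> / exp (L * (t - a))"
  have \<delta>: "0 < \<delta>" using \<open>0 < \<gamma>\<close> by (simp add: \<delta>_def)
  define p where "p s = sqrt (e s \<bullet> e s + \<delta>\<^sup>2)" for s
  have pos: "0 < e s \<bullet> e s + \<delta>\<^sup>2" for s
    using \<delta> by (simp add: add_nonneg_pos)
  have norm_le_p: "norm (e s) \<le> p s" for s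
    unfolding p_def norm_eq_sqrt_inner by simp
  have p_pos: "0 < p s" for s using pos by (simp add: p_def)
  define q where "q s = exp (- L * (s - a)) * p s - \<epsilon> * (s - a)" for s
  have cont: "continuous_on {a..b} e"
    using deriv by (rule continuous_on_vector_derivative)
  \<comment> \<open>Integrating factor and accumulated inhomogeneity turn the bound on \<open>p'\<close> into monotonicity.\<close>
  have "q t \<le> q a"
  proof (rule DERIV_nonpos_imp_decreasing_open[where f = q and a = a and b = t])
    show "a \<le> t" using t by simp
    show "continuous_on {a..t} q"
      unfolding q_def p_def
      by (intro continuous_intros continuous_on_subset[OF cont]) (use t in auto)
    fix s assume s: "a < s" "s < t"
    then have sb: "a < s" "s < b" using t by auto
    have "(e has_vector_derivative e' s) (at s)"
      using deriv[of s] sb by (simp add: at_within_Icc_at)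
    then have de: "(e has_derivative (\<lambda>h. h *\<^sub>R e' s)) (at s)"
      by (simp add: has_vector_derivative_def)
    have "((\<lambda>s. e s \<bullet> e s + \<delta>\<^sup>2) has_real_derivative 2 * (e s \<bullet> e' s)) (at s)"
      unfolding has_field_derivative_def
      by (rule has_derivative_eq_rhs[OF has_derivative_add[OF has_derivative_inner[OF de de] has_derivative_const]])
        (simp add: fun_eq_iff inner_commute)
    then have dp: "(p has_real_derivative (inverse (p s) / 2) * (2 * (e s \<bullet> e' s))) (at s)"
      unfolding p_def by (rule DERIV_chain2[where f = sqrt and g = "\<lambda>s. e s \<bullet> e s + \<delta>\<^sup>2", OF DERIV_real_sqrt[OF pos]])
    have dx: "((\<lambda>s. exp (- L * (s - a))) has_real_derivative - L * exp (- L * (s - a))) (at s)"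
      and da: "((\<lambda>s. \<epsilon> * (s - a)) has_real_derivative \<epsilon>) (at s)"
      by (auto intro!: derivative_eq_intros)
    have "(q has_real_derivative exp (- L * (s - a)) * ((e s \<bullet> e' s) / p s - L * p s) - \<epsilon>) (at s)"
      unfolding q_def
    proof (rule DERIV_cong[OF DERIV_diff[OF DERIV_mult[OF dx dp] da]])
      have "- L * E * P + inverse P / 2 * (2 * d) * E - \<epsilon> = E * (d / P - L * P) - \<epsilon>" for E P d :: real
        by (simp add: field_simps)
      then show "- L * exp (- L * (s - a)) * p s + inverse (p s) / 2 * (2 * (e s \<bullet> e' s)) * exp (- L * (s - a)) - \<epsilon> =
        exp (- L * (s - a)) * (e s \<bullet> e' s / p s - L * p s) - \<epsilon>" .
    qed
    moreover have "exp (- L * (s - a)) * ((e s \<bullet> e' s) / p s - L * p s) - \<epsilon> \<le> 0"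
    proof -
      have "e s \<bullet> e' s \<le> norm (e s) * norm (e' s)" by (rule norm_cauchy_schwarz)
      also have "\<dots> \<le> p s * (L * p s + \<epsilon>)"
      proof (rule mult_mono)
        have "norm (e' s) \<le> L * norm (e s) + \<epsilon>" using bound[of s] sb by simp
        also have "\<dots> \<le> L * p s + \<epsilon>" by (intro add_right_mono mult_left_mono norm_le_p nonneg)
        finally show "norm (e' s) \<le> L * p s + \<epsilon>" .
      qed (use norm_le_p[of s] p_pos[of s] in auto)
      finally have "(e s \<bullet> e' s) / p s - L * p s \<le> \<epsilon>"
        using p_pos[of s] by (simp add: pos_divide_le_eq algebra_simps)
      then have "exp (- L * (s - a)) * ((e s \<bullet> e' s) / p s - L * p s) \<le> exp (- L * (s - a)) * \<epsilon>"
        by (intro mult_left_mono) auto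
      also have "\<dots> \<le> 1 * \<epsilon>" using nonneg s by (intro mult_right_mono) auto
      finally show ?thesis by simp
    qed
    ultimately show "\<exists>y. (q has_real_derivative y) (at s) \<and> y \<le> 0" by blast
  qed
  then have "exp (- L * (t - a)) * p t \<le> p a + \<epsilon> * (t - a)" by (simp add: q_def)
  then have "exp (L * (t - a)) * (exp (- L * (t - a)) * p t) \<le> exp (L * (t - a)) * (p a + \<epsilon> * (t - a))"
    by (rule mult_left_mono) simp
  then have "p t \<le> exp (L * (t - a)) * (p a + \<epsilon> * (t - a))"
    by (simp flip: mult.assoc exp_add)
  moreover have "p a \<le> norm (e a) + \<delta>"
    unfolding p_def norm_eq_sqrt_inner using \<delta>
    by (intro real_le_lsqrt) (auto simp: power2_sum)
  then have "exp (L * (t - a)) * (p a + \<epsilon> * (t - a)) \<le> exp (L * (t - a)) * (norm (e a) + \<delta> + \<epsilon> * (t - a))"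
    by (intro mult_left_mono) auto
  ultimately have "norm (e t) \<le> exp (L * (t - a)) * (norm (e a) + \<delta> + \<epsilon> * (t - a))"
    using norm_le_p[of t] by linarith
  then show "norm (e t) \<le> exp (L * (t - a)) * (norm (e a) + \<epsilon> * (t - a)) + \<gamma>"
    by (simp add: \<delta>_def algebra_simps)
qed

lemma solves_ivp_subset:
  "solves_ivp g t0 x0 S x \<Longrightarrow> R \<subseteq> S \<Longrightarrow> solves_ivp g t0 x0 R x"
  unfolding solves_ivp_def by (meson has_vector_derivative_within_subset subsetD)

text \<open>
  The segment from \<open>t0\<close> to \<open>t\<close> may run in either direction of time. Reparametrising it affinely by
  \<open>{0..1}\<close> treats both directions at once, at the price of a factor \<open>\<bar>t - t0\<bar>\<close> in the Lipschitz constant.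
  The bound \<open>L\<close> is needed only along the two solutions that are compared, so a Lipschitz constant on
  a ball containing both of them suffices.
\<close>

lemma solves_ivp_unique:
  fixes g :: "real \<Rightarrow> 'a::real_inner \<Rightarrow> 'a"
  assumes x: "solves_ivp g t0 x0 (closed_segment t0 t) x"
    and z: "solves_ivp g t0 x0 (closed_segment t0 t) z"
    and L: "\<And>s. s \<in> closed_segment t0 t \<Longrightarrow> norm (g s (x s) - g s (z s)) \<le> L * norm (x s - z s)"
  shows "x t = z t"
proof -
  define c where "c s = t0 + s * (t - t0)" for s
  define e where "e s = x (c s) - z (c s)" for s
  have c_image: "c ` {0..1} = closed_segment t0 t"
    by (simp add: c_def closed_segment_real_eq mult.commute add.commute)
  have dc: "(c has_vector_derivative (t - t0)) (at s within {0..1})" for s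
    unfolding c_def by (auto intro!: derivative_eq_intros)
  have "norm (e 1) \<le> exp ((\<bar>t - t0\<bar> * \<bar>L\<bar>) * (1 - 0)) * (norm (e 0) + 0 * (1 - 0))"
  proof (rule growth_estimate)
    fix s :: real assume s: "s \<in> {0..1}"
    then have cs: "c s \<in> closed_segment t0 t" using c_image by blast
    have "((x \<circ> c) has_vector_derivative (t - t0) *\<^sub>R g (c s) (x (c s))) (at s within {0..1})"
      "((z \<circ> c) has_vector_derivative (t - t0) *\<^sub>R g (c s) (z (c s))) (at s within {0..1})"
      using x z cs by (auto intro!: vector_diff_chain_within dc simp: c_image solves_ivp_def)
    then show "(e has_vector_derivative (t - t0) *\<^sub>R (g (c s) (x (c s)) - g (c s) (z (c s)))) (at s within {0..1})"
      unfolding e_def o_def scaleR_diff_right by (rule has_vector_derivative_diff)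
    have "norm (g (c s) (x (c s)) - g (c s) (z (c s))) \<le> \<bar>L\<bar> * norm (e s)"
      using L[OF cs] by (smt (verit) e_def mult_right_mono norm_ge_zero)
    then show "norm ((t - t0) *\<^sub>R (g (c s) (x (c s)) - g (c s) (z (c s)))) \<le> (\<bar>t - t0\<bar> * \<bar>L\<bar>) * norm (e s) + 0"
      by (simp add: mult.assoc mult_left_mono)
  qed auto
  moreover have "e 0 = 0" using x z by (simp add: e_def c_def solves_ivp_def)
  ultimately show ?thesis by (simp add: e_def c_def)
qed

section \<open>Global solvability for Lipschitz right-hand sides\<close>

text \<open>
  Picard-Lindelof on the whole interval in one step: Banach's fixed point theorem is applied to
  \<open>v t = exp (- K * (t - a)) *\<^sub>R x t\<close> instead of \<open>x\<close>. With this exponential weight the integral operator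
  contracts by \<open>L / K\<close> whatever the length of the interval, so no short intervals have to be glued.
\<close>

lemma lipschitz_ivp_solvable:
  fixes g :: "real \<Rightarrow> 'a::euclidean_space \<Rightarrow> 'a"
  assumes cont: "continuous_on ({a..b} \<times> UNIV) (\<lambda>(t, x). g t x)"
    and lip: "\<And>t. t \<in> {a..b} \<Longrightarrow> L-lipschitz_on UNIV (g t)"
    and "a \<le> b"
  obtains x where "solves_ivp g a x0 {a..b} x"
proof -
  have "0 \<le> L" using lip[of a] \<open>a \<le> b\<close> lipschitz_on_nonneg by auto
  define K where "K = L + 1"
  have K: "0 < K" "L / K < 1" "0 \<le> L / K" using \<open>0 \<le> L\<close> by (auto simp: K_def)
  \<comment> \<open>Clamping the time to the interval makes the iterates bounded and continuous on the whole line.\<close>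
  define c where "c t = max a (min b t)" for t
  have c: "c t \<in> {a..b}" for t using \<open>a \<le> b\<close> by (auto simp: c_def)
  have c_id: "c t = t" if "t \<in> {a..b}" for t using that by (auto simp: c_def)
  define G where "G v s = g s (exp (K * (s - a)) *\<^sub>R apply_bcontfun v s)" for v :: "real \<Rightarrow>\<^sub>C 'a" and s
  define H where "H v s = exp (- K * (s - a)) *\<^sub>R (x0 + integral {a..s} (G v))" for v s
  have G_cont: "continuous_on {a..b} (G v)" for v
  proof -
    have "continuous_on {a..b} ((\<lambda>(t, x). g t x) \<circ> (\<lambda>s. (s, exp (K * (s - a)) *\<^sub>R apply_bcontfun v s)))"
      by (intro continuous_on_compose continuous_intros continuous_on_subset[OF cont]) auto
    then show ?thesis by (simp add: G_def o_def cong: continuous_on_cong)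
  qed
  have H_cont: "continuous_on {a..b} (H v)" for v
    unfolding H_def
    by (intro continuous_intros indefinite_integral_continuous_1 integrable_continuous_real G_cont)
  have "(\<lambda>t. H v (c t)) \<in> bcontfun" for v
  proof -
    have "continuous_on UNIV (H v \<circ> c)"
      using c by (intro continuous_on_compose continuous_on_subset[OF H_cont[of v]])
        (auto simp: c_def intro!: continuous_intros)
    moreover have "range (H v \<circ> c) \<subseteq> H v ` {a..b}" using c by auto
    then have "bounded (range (H v \<circ> c))"
      using compact_continuous_image[OF H_cont[of v] compact_Icc]
      by (meson bounded_subset compact_imp_bounded)
    ultimately show ?thesis by (simp add: bcontfun_def o_def)
  qed
  then have P: "apply_bcontfun (Bcontfun (\<lambda>t. H v (c t))) t = H v (c t)" for v t
    by (simp add: Bcontfun_inverse)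
  have "\<exists>!v. Bcontfun (\<lambda>t. H v (c t)) = v"
  proof (rule banach_fix_type[OF K(3,2)], intro allI)
    fix v w :: "real \<Rightarrow>\<^sub>C 'a"
    show "dist (Bcontfun (\<lambda>t. H v (c t))) (Bcontfun (\<lambda>t. H w (c t))) \<le> L / K * dist v w"
    proof (rule dist_bound, unfold P)
      fix t
      define s where "s = c t"
      have s: "a \<le> s" "s \<le> b" using c[of t] by (auto simp: s_def)
      have int: "G v integrable_on {a..s}" for v
        using s by (intro integrable_continuous_real continuous_on_subset[OF G_cont[of v]]) auto
      define E where "E r = L * dist v w * exp (K * (r - a))" for r
      have E: "(E has_integral (L * dist v w * (exp (K * (s - a)) - 1) / K)) {a..s}"
      proof -
        have "(E has_integral (L * dist v w * exp (K * (s - a)) / K - L * dist v w * exp (K * (a - a)) / K)) {a..s}"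
          unfolding E_def using s K
          by (intro fundamental_theorem_of_calculus)
            (auto intro!: derivative_eq_intros simp flip: has_real_derivative_iff_has_vector_derivative)
        then show ?thesis by (simp add: right_diff_distrib diff_divide_distrib)
      qed
      have "norm (integral {a..s} (\<lambda>r. G v r - G w r)) \<le> integral {a..s} E"
      proof (rule integral_norm_bound_integral)
        show "(\<lambda>r. G v r - G w r) integrable_on {a..s}" using int by (intro integrable_diff)
        show "E integrable_on {a..s}" using E by blast
        fix r assume r: "r \<in> {a..s}"
        have "dist (G v r) (G w r) \<le> L * dist (exp (K * (r - a)) *\<^sub>R apply_bcontfun v r) (exp (K * (r - a)) *\<^sub>R apply_bcontfun w r)"
          unfolding G_def using r s by (intro lipschitz_onD[OF lip]) auto
        also have "\<dots> = L * (exp (K * (r - a)) * dist (apply_bcontfun v r) (apply_bcontfun w r))"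
          by (simp add: dist_norm flip: scaleR_diff_right)
        also have "\<dots> \<le> L * (exp (K * (r - a)) * dist v w)"
          using \<open>0 \<le> L\<close> by (intro mult_left_mono dist_bounded) auto
        finally show "norm (G v r - G w r) \<le> E r" by (simp add: E_def dist_norm algebra_simps)
      qed
      also have "\<dots> = L * dist v w * (exp (K * (s - a)) - 1) / K"
        using E by (rule integral_unique)
      also have "\<dots> \<le> L * dist v w * exp (K * (s - a)) / K"
        using \<open>0 \<le> L\<close> K by (intro divide_right_mono mult_left_mono) auto
      finally have "exp (- K * (s - a)) * norm (integral {a..s} (\<lambda>r. G v r - G w r))
          \<le> exp (- K * (s - a)) * (L * dist v w * exp (K * (s - a)) / K)"
        by (rule mult_left_mono) auto
      also have "\<dots> = L / K * dist v w"
        by (simp add: mult_ac flip: exp_add)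
      finally show "dist (H v (c t)) (H w (c t)) \<le> L / K * dist v w"
        using int by (simp add: H_def dist_norm integral_diff flip: s_def scaleR_diff_right)
    qed
  qed
  then obtain v where "Bcontfun (\<lambda>t. H v (c t)) = v" by blast
  then have v: "apply_bcontfun v t = H v t" if "t \<in> {a..b}" for t
    using P[of v t] c_id[OF that] by simp
  define x where "x t = x0 + integral {a..t} (G v)" for t
  have "solves_ivp g a x0 {a..b} x"
    unfolding solves_ivp_def
  proof (intro conjI ballI)
    show "x a = x0" by (simp add: x_def)
    fix t assume t: "t \<in> {a..b}"
    have "G v t = g t (x t)"
      by (simp add: G_def v[OF t] H_def x_def flip: exp_add)
    moreover have "(x has_vector_derivative G v t) (at t within {a..b})"
      unfolding x_def using integral_has_vector_derivative[OF G_cont t]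
      by (auto intro!: derivative_eq_intros)
    ultimately show "(x has_vector_derivative g t (x t)) (at t within {a..b})" by simp
  qed
  then show thesis ..
qed

lemma solves_ivp_continuous_on: "solves_ivp g t0 x0 S x \<Longrightarrow> continuous_on S x"
  unfolding solves_ivp_def by (rule continuous_on_vector_derivative[where f' = "\<lambda>t. g t (x t)"]) auto

lemma solves_ivp_cong:
  assumes "solves_ivp g t0 x0 S x" "\<And>t. t \<in> S \<Longrightarrow> g t (x t) = h t (x t)"
  shows "solves_ivp h t0 x0 S x"
  using assms by (simp add: solves_ivp_def)

text \<open>
  Since \<open>ivp_value\<close> is a definite description, it can be evaluated only together with uniqueness.
  The constant \<open>L\<close> may depend on the competing solution \<open>z\<close>: nothing is known in advance about how
  far \<open>z\<close> travels.
\<close>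

lemma ivp_value_eqI:
  fixes g :: "real \<Rightarrow> 'a::real_inner \<Rightarrow> 'a"
  assumes x: "solves_ivp g t0 x0 (closed_segment t0 t) x"
    and L: "\<And>z. solves_ivp g t0 x0 (closed_segment t0 t) z \<Longrightarrow>
      \<exists>L. \<forall>s\<in>closed_segment t0 t. norm (g s (x s) - g s (z s)) \<le> L * norm (x s - z s)"
  shows "ivp_value g t0 x0 t = x t"
  unfolding ivp_value_def
proof (rule the_equality)
  fix v assume "\<exists>z. solves_ivp g t0 x0 (closed_segment t0 t) z \<and> z t = v"
  then obtain z where z: "solves_ivp g t0 x0 (closed_segment t0 t) z" "z t = v" by blast
  obtain L where "\<forall>s\<in>closed_segment t0 t. norm (g s (x s) - g s (z s)) \<le> L * norm (x s - z s)"
    using L[OF z(1)] ..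
  then have "x t = z t" by (intro solves_ivp_unique[OF x z(1)]) auto
  then show "v = x t" using z by simp
next
  show "\<exists>z. solves_ivp g t0 x0 (closed_segment t0 t) z \<and> z t = x t" using x by auto
qed

section \<open>Locally Lipschitz autonomous equations\<close>

definition lipschitz_on_balls :: "('a::real_normed_vector \<Rightarrow> 'b::metric_space) \<Rightarrow> bool" where
  "lipschitz_on_balls F \<longleftrightarrow> (\<forall>R. \<exists>L. L-lipschitz_on (cball 0 R) F)"

lemma continuous_image_in_cball:
  fixes x :: "real \<Rightarrow> 'a::real_normed_vector"
  assumes "compact S" "continuous_on S x"
  obtains R where "0 \<le> R" "x ` S \<subseteq> cball 0 R"
proof -
  have "bounded (x ` S)" using assms by (simp add: compact_continuous_image compact_imp_bounded)
  then obtain R where "\<forall>y\<in>x ` S. norm y \<le> R" unfolding bounded_iff by blast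
  then have "x ` S \<subseteq> cball 0 (max 0 R)" by (force simp: subset_eq)
  then show thesis using that[of "max 0 R"] by simp
qed

text \<open>
  Two solutions on a compact segment stay in a common ball, on which \<open>F\<close> is Lipschitz.
\<close>

lemma ivp_value_autonomous:
  fixes F :: "'a::real_inner \<Rightarrow> 'a"
  assumes F: "lipschitz_on_balls F" and x: "solves_ivp (\<lambda>_. F) t0 x0 (closed_segment t0 t) x"
  shows "ivp_value (\<lambda>_. F) t0 x0 t = x t"
proof (rule ivp_value_eqI[OF x])
  fix z assume z: "solves_ivp (\<lambda>_. F) t0 x0 (closed_segment t0 t) z"
  obtain R1 where R1: "x ` closed_segment t0 t \<subseteq> cball 0 R1"
    using continuous_image_in_cball[OF compact_segment solves_ivp_continuous_on[OF x]] by blast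
  obtain R2 where R2: "z ` closed_segment t0 t \<subseteq> cball 0 R2"
    using continuous_image_in_cball[OF compact_segment solves_ivp_continuous_on[OF z]] by blast
  obtain L where L: "L-lipschitz_on (cball 0 (max R1 R2)) F"
    using F unfolding lipschitz_on_balls_def by blast
  have "norm (F (x s) - F (z s)) \<le> L * norm (x s - z s)" if "s \<in> closed_segment t0 t" for s
  proof -
    have "x s \<in> cball 0 R1" "z s \<in> cball 0 R2" using R1 R2 that by blast+
    then have "x s \<in> cball 0 (max R1 R2)" "z s \<in> cball 0 (max R1 R2)" by auto
    then show ?thesis using lipschitz_onD[OF L] by (simp add: dist_norm)
  qed
  then show "\<exists>L. \<forall>s\<in>closed_segment t0 t. norm (F (x s) - F (z s)) \<le> L * norm (x s - z s)" by blast
qed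

text \<open>
  The cutoff is composition with the nearest-point projection onto the ball, which is 1-Lipschitz.
  It gives access to the global existence theorem; solutions of the cut-off equation that stay in the
  ball solve the original equation.
\<close>

lemma lipschitz_cutoff:
  fixes F :: "'a::euclidean_space \<Rightarrow> 'b::metric_space"
  assumes F: "lipschitz_on_balls F" and "0 \<le> R"
  obtains G L where "L-lipschitz_on UNIV G" "\<And>x. x \<in> cball 0 R \<Longrightarrow> G x = F x"
proof -
  obtain L where L: "L-lipschitz_on (cball 0 R) F" using F unfolding lipschitz_on_balls_def by blast
  have ne: "cball (0::'a) R \<noteq> {}" using \<open>0 \<le> R\<close> by simp
  have "1-lipschitz_on UNIV (closest_point (cball (0::'a) R))"
    using closest_point_lipschitz[OF convex_cball closed_cball ne] by (intro lipschitz_onI) auto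
  moreover have "L-lipschitz_on (closest_point (cball (0::'a) R) ` UNIV) F"
    using closest_point_in_set[OF closed_cball ne] by (intro lipschitz_on_subset[OF L]) blast
  ultimately have "(L * 1)-lipschitz_on UNIV (\<lambda>x. F (closest_point (cball 0 R) x))"
    by (rule lipschitz_on_compose2)
  then show thesis
    using that[of "L * 1" "\<lambda>x. F (closest_point (cball 0 R) x)"] by (simp add: closest_point_self)
qed

lemma lipschitz_autonomous_ivp_solvable:
  fixes G :: "'a::euclidean_space \<Rightarrow> 'a"
  assumes G: "L-lipschitz_on UNIV G" and "a \<le> b"
  obtains x where "solves_ivp (\<lambda>_. G) a x0 {a..b} x"
proof (rule lipschitz_ivp_solvable[of a b "\<lambda>_. G" L])
  have "continuous_on ({a..b} \<times> UNIV) (\<lambda>p. G (snd p))"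
    by (intro continuous_on_compose2[OF lipschitz_on_continuous_on[OF G]] continuous_intros) auto
  then show "continuous_on ({a..b} \<times> UNIV) (\<lambda>(t, x). G x)" by (simp add: case_prod_unfold)
qed (use assms in auto)

text \<open>
  Perturbed solutions live as long as \<open>u\<close> does: solve the equation cut off outside a ball whose radius
  exceeds the size of \<open>u\<close> by 1. By the growth estimate the solution from \<open>x1\<close> deviates from \<open>u\<close> by at
  most \<open>C * norm (x1 - x0)\<close>, which is below 1 for \<open>x1\<close> close to \<open>x0\<close>; so the cutoff is never felt.
\<close>

lemma nearby_solutions:
  fixes F :: "'a::euclidean_space \<Rightarrow> 'a"
  assumes F: "lipschitz_on_balls F" and u: "solves_ivp (\<lambda>_. F) a x0 {a..b} u" and "a \<le> b"
  obtains \<delta> C where "0 < \<delta>" "0 \<le> C"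
    "\<And>x1. norm (x1 - x0) < \<delta> \<Longrightarrow> \<exists>x. solves_ivp (\<lambda>_. F) a x1 {a..b} x \<and>
      (\<forall>t\<in>{a..b}. norm (x t - u t) \<le> C * norm (x1 - x0))"
proof -
  obtain R where R: "0 \<le> R" "u ` {a..b} \<subseteq> cball 0 R"
    using continuous_image_in_cball[OF compact_Icc solves_ivp_continuous_on[OF u]] by blast
  have "0 \<le> R + 1" using R by simp
  then obtain G L where G: "L-lipschitz_on UNIV G" and GF: "\<And>x. x \<in> cball 0 (R + 1) \<Longrightarrow> G x = F x"
    using lipschitz_cutoff[OF F] by metis
  have "0 \<le> L" using lipschitz_on_nonneg[OF G] .
  define C where "C = exp (L * (b - a))"
  show thesis
  \<comment> \<open>With this radius the deviation bound \<open>C * norm (x1 - x0)\<close> stays below 1.\<close>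
  proof (rule that[of "1 / C" C])
    show "0 < 1 / C" "0 \<le> C" by (auto simp: C_def)
    fix x1 assume x1: "norm (x1 - x0) < 1 / C"
    obtain x where x: "solves_ivp (\<lambda>_. G) a x1 {a..b} x"
      using lipschitz_autonomous_ivp_solvable[OF G \<open>a \<le> b\<close>] by blast
    have close: "norm (x t - u t) \<le> C * norm (x1 - x0)" if t: "t \<in> {a..b}" for t
    proof -
      have "norm (x t - u t) \<le> exp (L * (t - a)) * (norm (x a - u a) + 0 * (t - a))"
      proof (rule growth_estimate[where b = b])
        fix s assume s: "s \<in> {a..b}"
        then have "u s \<in> cball 0 R" using R by blast
        then have us: "G (u s) = F (u s)" using GF by simp
        show "((\<lambda>t. x t - u t) has_vector_derivative G (x s) - G (u s)) (at s within {a..b})"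
          using x u s unfolding us by (intro has_vector_derivative_diff) (auto simp: solves_ivp_def)
        show "norm (G (x s) - G (u s)) \<le> L * norm (x s - u s) + 0"
          using lipschitz_onD[OF G, of "x s" "u s"] by (simp add: dist_norm)
      qed (use t \<open>0 \<le> L\<close> in auto)
      also have "\<dots> \<le> C * norm (x1 - x0)"
        unfolding C_def using x u t \<open>0 \<le> L\<close>
        by (auto simp: solves_ivp_def intro!: mult_right_mono mult_left_mono)
      finally show ?thesis .
    qed
    have "x t \<in> cball 0 (R + 1)" if t: "t \<in> {a..b}" for t
    proof -
      have "norm (x t - u t) \<le> 1"
        using close[OF t] x1 by (simp add: C_def field_simps)
      moreover have "u t \<in> cball 0 R" using R t by blast
      ultimately show ?thesis using norm_triangle_sub[of "x t" "u t"] by simp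
    qed
    then have "solves_ivp (\<lambda>_. F) a x1 {a..b} x"
      using GF by (intro solves_ivp_cong[OF x]) auto
    then show "\<exists>x. solves_ivp (\<lambda>_. F) a x1 {a..b} x \<and>
      (\<forall>t\<in>{a..b}. norm (x t - u t) \<le> C * norm (x1 - x0))" using close by blast
  qed
qed

text \<open>
  Solutions of the cut-off equation exist on all compact intervals, and by continuity the one through
  \<open>x0\<close> stays in the ball slightly beyond \<open>{a..b}\<close>. To reach times before \<open>a\<close>, the equation is run backwards for
  one time unit; the end point \<open>w 1\<close> then serves as the initial value at time \<open>a - 1\<close> of a single forward
  solution \<open>v\<close>, which passes through \<open>x0\<close> at time \<open>a\<close> by uniqueness.
\<close>

lemma solution_extends:
  fixes F :: "'a::euclidean_space \<Rightarrow> 'a"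
  assumes F: "lipschitz_on_balls F" and u: "solves_ivp (\<lambda>_. F) a x0 {a..b} u" and "a \<le> b"
  obtains \<delta> v where "0 < \<delta>" "solves_ivp (\<lambda>_. F) a x0 {a - \<delta>..b + \<delta>} v"
    "\<And>t. t \<in> {a..b} \<Longrightarrow> v t = u t"
proof -
  obtain R where R: "0 \<le> R" "u ` {a..b} \<subseteq> cball 0 R"
    using continuous_image_in_cball[OF compact_Icc solves_ivp_continuous_on[OF u]] by blast
  have "0 \<le> R + 1" using R by simp
  then obtain G L where G: "L-lipschitz_on UNIV G" and GF: "\<And>x. x \<in> cball 0 (R + 1) \<Longrightarrow> G x = F x"
    using lipschitz_cutoff[OF F] by metis
  have G_unique: "x t = z t"
    if "solves_ivp (\<lambda>_. G) t0 p (closed_segment t0 t) x" "solves_ivp (\<lambda>_. G) t0 p (closed_segment t0 t) z"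
    for t0 p t x z
    using solves_ivp_unique[OF that, of L] lipschitz_onD[OF G] by (simp add: dist_norm)
  have "L-lipschitz_on UNIV (\<lambda>x. - G x)"
    using G by (simp add: lipschitz_on_def dist_norm norm_minus_commute)
  then obtain w where w: "solves_ivp (\<lambda>_ x. - G x) 0 x0 {0..1} w"
    using lipschitz_autonomous_ivp_solvable[of L "\<lambda>x. - G x" 0 1] by auto
  define z where "z t = w (a - t)" for t
  have z: "solves_ivp (\<lambda>_. G) (a - 1) (w 1) {a - 1..a} z"
    unfolding solves_ivp_def
  proof (intro conjI ballI)
    fix t assume t: "t \<in> {a - 1..a}"
    have im: "(\<lambda>t. a - t) ` {a - 1..a} = {0..1}" by (simp add: image_diff_atLeastAtMost)
    have "((w \<circ> (\<lambda>t. a - t)) has_vector_derivative (- 1) *\<^sub>R (- G (w (a - t)))) (at t within {a - 1..a})"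
    proof (rule vector_diff_chain_within)
      show "((\<lambda>t. a - t) has_vector_derivative - 1) (at t within {a - 1..a})"
        by (auto intro!: derivative_eq_intros)
      show "(w has_vector_derivative - G (w (a - t))) (at (a - t) within (\<lambda>t. a - t) ` {a - 1..a})"
        using w t unfolding im solves_ivp_def by simp
    qed
    then show "(z has_vector_derivative G (z t)) (at t within {a - 1..a})"
      by (simp add: z_def[abs_def] o_def)
  qed (simp add: z_def)
  have "a - 1 \<le> b + 1" using \<open>a \<le> b\<close> by simp
  then obtain v where v: "solves_ivp (\<lambda>_. G) (a - 1) (w 1) {a - 1..b + 1} v"
    using lipschitz_autonomous_ivp_solvable[OF G] by blast
  have "v a = z a"
    using \<open>a \<le> b\<close> z by (intro G_unique[where x = v and z = z and t = a, OF solves_ivp_subset[OF v]])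
      (auto simp: closed_segment_eq_real_ivl)
  then have "v a = x0" using w by (simp add: z_def solves_ivp_def)
  then have va: "solves_ivp (\<lambda>_. G) a x0 {a - 1..b + 1} v" using v by (simp add: solves_ivp_def)
  have uG: "solves_ivp (\<lambda>_. G) a x0 {a..b} u"
  proof (rule solves_ivp_cong[OF u])
    fix t assume "t \<in> {a..b}"
    then have "u t \<in> cball 0 R" using R by blast
    then show "F (u t) = G (u t)" using GF by simp
  qed
  have v_eq: "v t = u t" if "t \<in> {a..b}" for t
    using that by (intro G_unique[where x = v and z = u and t = t, OF solves_ivp_subset[OF va] solves_ivp_subset[OF uG]])
      (auto simp: closed_segment_eq_real_ivl)
  have "uniformly_continuous_on {a - 1..b + 1} v"
    by (intro compact_uniformly_continuous solves_ivp_continuous_on[OF va] compact_Icc)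
  then obtain d where d: "0 < d"
    "\<And>s t. s \<in> {a - 1..b + 1} \<Longrightarrow> t \<in> {a - 1..b + 1} \<Longrightarrow> dist s t < d \<Longrightarrow> dist (v s) (v t) < 1"
    unfolding uniformly_continuous_on_def by (metis zero_less_one)
  define \<delta> where "\<delta> = min 1 (d / 2)"
  have \<delta>: "0 < \<delta>" "\<delta> < d" "\<delta> \<le> 1" using d by (auto simp: \<delta>_def)
  have "v t \<in> cball 0 (R + 1)" if t: "t \<in> {a - \<delta>..b + \<delta>}" for t
  proof -
    define s where "s = max a (min b t)"
    have s: "s \<in> {a..b}" "dist t s < d" using t \<delta> \<open>a \<le> b\<close> by (auto simp: s_def dist_real_def)
    have "dist (v t) (v s) < 1" using s t \<delta> by (intro d) auto
    moreover have "u s \<in> cball 0 R" using R s(1) by blast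
    then have "norm (v s) \<le> R" using v_eq[OF s(1)] by simp
    ultimately show ?thesis using norm_triangle_sub[of "v t" "v s"] by (simp add: dist_norm)
  qed
  then have "solves_ivp (\<lambda>_. F) a x0 {a - \<delta>..b + \<delta>} v"
    using \<delta> GF by (intro solves_ivp_cong[OF solves_ivp_subset[OF va]]) auto
  then show thesis using that \<delta> v_eq by blast
qed

section \<open>Differentiability of the flow in the initial value\<close>

lemma C1_lipschitz_on_balls:
  fixes F :: "'a::euclidean_space \<Rightarrow> 'b::real_normed_vector" and F' :: "'a \<Rightarrow> 'a \<Rightarrow>\<^sub>L 'b"
  assumes F: "\<And>x. (F has_derivative F' x) (at x)" and F': "continuous_on UNIV F'"
  shows "lipschitz_on_balls F"
  unfolding lipschitz_on_balls_def
proof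
  fix R
  have "bounded (F' ` cball 0 R)"
    using continuous_on_subset[OF F'] by (intro compact_imp_bounded compact_continuous_image) auto
  then obtain B where B: "0 < B" "\<forall>y\<in>F' ` cball 0 R. norm y \<le> B" unfolding bounded_pos by blast
  have "norm (F x - F y) \<le> B * norm (x - y)" if "x \<in> cball 0 R" "y \<in> cball 0 R" for x y
  proof (rule differentiable_bound[OF convex_cball _ _ that])
    show "(F has_derivative F' x) (at x within cball 0 R)" for x
      using F by (rule has_derivative_at_withinI)
    show "onorm (F' x) \<le> B" if "x \<in> cball 0 R" for x
      using B that by (simp add: norm_blinfun.rep_eq[symmetric])
  qed
  then show "\<exists>L. L-lipschitz_on (cball 0 R) F"
    using B by (intro exI[of _ B] lipschitz_onI) (auto simp: dist_norm)
qed

text \<open>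
  For a \<open>C\<^sup>1\<close> map the remainder of the linearization is small uniformly over base points in a ball,
  because the derivative is uniformly continuous on a slightly larger ball.
\<close>

lemma C1_uniform_linearization:
  fixes F :: "'a::euclidean_space \<Rightarrow> 'b::real_normed_vector" and F' :: "'a \<Rightarrow> 'a \<Rightarrow>\<^sub>L 'b"
  assumes F: "\<And>x. (F has_derivative F' x) (at x)" and F': "continuous_on UNIV F'" and "0 < \<epsilon>"
  obtains \<delta> where "0 < \<delta>"
    "\<And>x y. norm x \<le> R \<Longrightarrow> norm (y - x) < \<delta> \<Longrightarrow> norm (F y - F x - F' x (y - x)) \<le> \<epsilon> * norm (y - x)"
proof -
  have "uniformly_continuous_on (cball 0 (R + 1)) F'"
    using continuous_on_subset[OF F'] by (intro compact_uniformly_continuous) auto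
  then obtain d where d: "0 < d" "\<And>x y. x \<in> cball 0 (R + 1) \<Longrightarrow> y \<in> cball 0 (R + 1) \<Longrightarrow>
      dist y x < d \<Longrightarrow> dist (F' y) (F' x) < \<epsilon>"
    using \<open>0 < \<epsilon>\<close> unfolding uniformly_continuous_on_def by metis
  show thesis
  proof (rule that[of "min 1 d"])
    fix x y :: 'a assume x: "norm x \<le> R" and y: "norm (y - x) < min 1 d"
    have "norm (F y - F x - F' x (y - x)) \<le> norm (y - x) * \<epsilon>"
    proof (rule differentiable_bound_linearization[where S = "ball x (min 1 d)"])
      fix z assume "z \<in> ball x (min 1 d)"
      then have z: "norm (z - x) < min 1 d" by (simp add: dist_norm norm_minus_commute)
      then have "norm z \<le> R + 1" using x norm_triangle_sub[of z x] by simp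
      then have "norm (F' z - F' x) \<le> \<epsilon>"
        using d(2)[of x z] x z by (simp add: dist_norm)
      then show "onorm (blinfun_apply (F' z) - blinfun_apply (F' x)) \<le> \<epsilon>"
        by (simp add: norm_blinfun.rep_eq minus_blinfun.rep_eq fun_diff_def)
    next
      fix t :: real assume "t \<in> {0..1}"
      then have "norm (t *\<^sub>R (y - x)) \<le> norm (y - x)" by (simp add: mult_left_le_one_le)
      then show "x + t *\<^sub>R (y - x) \<in> ball x (min 1 d)" using y by (simp add: dist_norm)
    qed (use d in \<open>auto intro: has_derivative_at_withinI[OF F]\<close>)
    then show "norm (F y - F x - F' x (y - x)) \<le> \<epsilon> * norm (y - x)" by (simp add: mult.commute)
  qed (use d in auto)
qed

text \<open>
  The error \<open>e t = x t - u t - D t h\<close> of the linear prediction, where \<open>x\<close> starts at \<open>x0 + h\<close>, satisfies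
  \<open>e' = F' (u t) e + r\<close>, where \<open>r\<close> is the linearization remainder of \<open>F\<close> between \<open>x t\<close> and \<open>u t\<close>. As
  \<open>norm (x t - u t) \<le> C * norm h\<close> uniformly in \<open>t\<close>, the remainder is at most \<open>\<epsilon> * C * norm h\<close> for small
  \<open>h\<close>. Since \<open>e a = 0\<close>, the growth estimate gives \<open>norm (e t) \<le> const * \<epsilon> * norm h\<close>.
\<close>

lemma flow_has_derivative:
  fixes F :: "'a::euclidean_space \<Rightarrow> 'a" and F' :: "'a \<Rightarrow> 'a \<Rightarrow>\<^sub>L 'a"
  assumes F: "\<And>x. (F has_derivative F' x) (at x)" and F': "continuous_on UNIV F'"
    and u: "solves_ivp (\<lambda>_. F) a x0 {a..b} u"
    and D: "\<And>h. solves_ivp (\<lambda>t. F' (u t)) a h {a..b} (\<lambda>t. D t h)"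
    and lin: "bounded_linear (D t)" and t: "t \<in> {a..b}"
  shows "((\<lambda>x1. ivp_value (\<lambda>_. F) a x1 t) has_derivative D t) (at x0)"
proof -
  note lip = C1_lipschitz_on_balls[OF F F']
  have ab: "a \<le> b" using t by simp
  have value_eq: "ivp_value (\<lambda>_. F) a x1 t = x t" if "solves_ivp (\<lambda>_. F) a x1 {a..b} x" for x1 x
    using t by (intro ivp_value_autonomous[OF lip] solves_ivp_subset[OF that])
      (auto simp: closed_segment_eq_real_ivl)
  obtain d C where d: "0 < d" and C: "0 \<le> C"
    and near: "\<And>x1. norm (x1 - x0) < d \<Longrightarrow> \<exists>x. solves_ivp (\<lambda>_. F) a x1 {a..b} x \<and>
      (\<forall>t\<in>{a..b}. norm (x t - u t) \<le> C * norm (x1 - x0))"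
    using nearby_solutions[OF lip u ab] by metis
  obtain R where R: "0 \<le> R" "u ` {a..b} \<subseteq> cball 0 R"
    using continuous_image_in_cball[OF compact_Icc solves_ivp_continuous_on[OF u]] by blast
  have "bounded (F' ` cball 0 R)"
    using continuous_on_subset[OF F'] by (intro compact_imp_bounded compact_continuous_image) auto
  then obtain M where M: "0 < M" "\<forall>y\<in>F' ` cball 0 R. norm y \<le> M" unfolding bounded_pos by blast
  \<comment> \<open>The summand 1 keeps \<open>c\<close> positive when \<open>C = 0\<close> or \<open>t = a\<close>.\<close>
  define c where "c = exp (M * (t - a)) * (C * (t - a)) + 1"
  have c: "0 < c" using C t by (auto simp: c_def intro!: add_nonneg_pos)
  show ?thesis
    unfolding has_derivative_at_alt
  proof (intro conjI allI impI lin)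
    fix \<gamma> :: real assume "0 < \<gamma>"
    define \<epsilon> where "\<epsilon> = \<gamma> / c"
    have \<epsilon>: "0 < \<epsilon>" "\<epsilon> * c = \<gamma>" using c \<open>0 < \<gamma>\<close> by (auto simp: \<epsilon>_def)
    obtain \<rho> where \<rho>: "0 < \<rho>" "\<And>x y. norm x \<le> R \<Longrightarrow> norm (y - x) < \<rho> \<Longrightarrow>
        norm (F y - F x - F' x (y - x)) \<le> \<epsilon> * norm (y - x)"
      using C1_uniform_linearization[OF F F' \<epsilon>(1), of R] by blast
    show "\<exists>\<delta>>0. \<forall>x1. norm (x1 - x0) < \<delta> \<longrightarrow>
      norm (ivp_value (\<lambda>_. F) a x1 t - ivp_value (\<lambda>_. F) a x0 t - D t (x1 - x0)) \<le> \<gamma> * norm (x1 - x0)"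
    proof (intro exI[of _ "min d (\<rho> / (C + 1))"] conjI allI impI)
      show "0 < min d (\<rho> / (C + 1))" using d \<rho> C by simp
      fix x1 assume x1: "norm (x1 - x0) < min d (\<rho> / (C + 1))"
      define h where "h = x1 - x0"
      obtain x where x: "solves_ivp (\<lambda>_. F) a x1 {a..b} x"
        and x_near: "\<And>t. t \<in> {a..b} \<Longrightarrow> norm (x t - u t) \<le> C * norm h"
        using near[of x1] x1 by (auto simp: h_def)
      have "(C + 1) * norm h < \<rho>" using x1 C by (simp add: h_def field_simps)
      then have C_h: "C * norm h < \<rho>" using norm_ge_zero[of h] unfolding distrib_right by linarith
      have "norm (x t - u t - D t h) \<le> exp (M * (t - a)) * (norm (x a - u a - D a h) + \<epsilon> * (C * norm h) * (t - a))"
      proof (rule growth_estimate[where b = b])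
        fix s assume s: "s \<in> {a..b}"
        show "((\<lambda>t. x t - u t - D t h) has_vector_derivative F (x s) - F (u s) - F' (u s) (D s h)) (at s within {a..b})"
          using x u D[of h] s by (intro has_vector_derivative_diff) (auto simp: solves_ivp_def)
        have us: "u s \<in> cball 0 R" using R s by blast
        then have "norm (F' (u s)) \<le> M" using M by blast
        then have 1: "norm (F' (u s) (x s - u s - D s h)) \<le> M * norm (x s - u s - D s h)"
          by (rule order_trans[OF norm_blinfun mult_right_mono]) simp
        have "norm (F (x s) - F (u s) - F' (u s) (x s - u s)) \<le> \<epsilon> * norm (x s - u s)"
          using us x_near[OF s] C_h by (intro \<rho>) auto
        also have "\<dots> \<le> \<epsilon> * (C * norm h)" using x_near[OF s] \<epsilon> by (intro mult_left_mono) auto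
        finally have 2: "norm (F (x s) - F (u s) - F' (u s) (x s - u s)) \<le> \<epsilon> * (C * norm h)" .
        have "F (x s) - F (u s) - F' (u s) (D s h) =
            F' (u s) (x s - u s - D s h) + (F (x s) - F (u s) - F' (u s) (x s - u s))"
          by (simp add: blinfun.diff_right)
        then show "norm (F (x s) - F (u s) - F' (u s) (D s h)) \<le> M * norm (x s - u s - D s h) + \<epsilon> * (C * norm h)"
          using norm_triangle_mono[OF 1 2] by (simp only:)
      qed (use M \<epsilon> C t in auto)
      also have "x a - u a - D a h = 0" using x u D[of h] by (simp add: solves_ivp_def h_def)
      also have "exp (M * (t - a)) * (norm (0::'a) + \<epsilon> * (C * norm h) * (t - a)) \<le> \<epsilon> * c * norm h"
        using \<epsilon>(1) by (simp add: c_def algebra_simps)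
      finally show "norm (ivp_value (\<lambda>_. F) a x1 t - ivp_value (\<lambda>_. F) a x0 t - D t (x1 - x0)) \<le> \<gamma> * norm (x1 - x0)"
        using \<epsilon>(2) by (simp add: value_eq[OF x] value_eq[OF u] h_def)
    qed
  qed
qed

section \<open>Linear equations and the fundamental matrix\<close>

text \<open>
  The bilinear map \<open>B\<close> lets the lemmas on linear equations serve matrix products from the left and from
  the right as well as the product of a matrix with a vector.
\<close>

lemma linear_rhs_lipschitz:
  assumes B: "bounded_bilinear B" and S: "compact S" and A: "continuous_on S A"
  obtains L where "0 \<le> L" "\<And>t x y. t \<in> S \<Longrightarrow> norm (B (A t) x - B (A t) y) \<le> L * norm (x - y)"
proof -
  interpret B: bounded_bilinear B by (rule B)
  obtain K where K: "0 < K" "\<And>a x. norm (B a x) \<le> norm a * norm x * K" using B.pos_bounded by blast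
  have "bounded (A ` S)" using A S by (simp add: compact_continuous_image compact_imp_bounded)
  then obtain M where M: "0 < M" "\<And>a. a \<in> A ` S \<Longrightarrow> norm a \<le> M" unfolding bounded_pos by metis
  show thesis
  proof (rule that[of "M * K"])
    fix t x y assume "t \<in> S"
    then have "norm (A t) \<le> M" using M by simp
    have "norm (B (A t) x - B (A t) y) \<le> norm (A t) * norm (x - y) * K"
      using K(2) by (simp flip: B.diff_right)
    also have "\<dots> \<le> M * norm (x - y) * K"
      using \<open>norm (A t) \<le> M\<close> K by (intro mult_right_mono) auto
    finally show "norm (B (A t) x - B (A t) y) \<le> M * K * norm (x - y)" by (simp add: mult_ac)
  qed (use M K in auto)
qed

lemma linear_ivp_unique:
  fixes x :: "real \<Rightarrow> 'a::real_inner"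
  assumes B: "bounded_bilinear B" and A: "continuous_on (closed_segment t0 t) A"
    and x: "solves_ivp (\<lambda>t. B (A t)) t0 x0 (closed_segment t0 t) x"
    and z: "solves_ivp (\<lambda>t. B (A t)) t0 x0 (closed_segment t0 t) z"
  shows "x t = z t"
proof -
  obtain L where "\<And>s x y. s \<in> closed_segment t0 t \<Longrightarrow> norm (B (A s) x - B (A s) y) \<le> L * norm (x - y)"
    using linear_rhs_lipschitz[OF B compact_segment A] by metis
  then show ?thesis by (intro solves_ivp_unique[OF x z, of L]) auto
qed

lemma linear_ivp_solvable:
  fixes x0 :: "'a::euclidean_space"
  assumes B: "bounded_bilinear B" and A: "continuous_on {a..b} A" and "a \<le> b"
  obtains x where "solves_ivp (\<lambda>t. B (A t)) a x0 {a..b} x"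
proof -
  interpret B: bounded_bilinear B by (rule B)
  obtain L where L: "0 \<le> L" "\<And>t x y. t \<in> {a..b} \<Longrightarrow> norm (B (A t) x - B (A t) y) \<le> L * norm (x - y)"
    using linear_rhs_lipschitz[OF B compact_Icc A] by metis
  show thesis
  proof (rule lipschitz_ivp_solvable[of a b "\<lambda>t. B (A t)" L])
    show "continuous_on ({a..b} \<times> UNIV) (\<lambda>(t, x). B (A t) x)"
      unfolding case_prod_unfold
      by (intro B.continuous_on continuous_on_compose2[OF A] continuous_intros) auto
    show "L-lipschitz_on UNIV (B (A t))" if "t \<in> {a..b}" for t
      using L that by (intro lipschitz_onI) (auto simp: dist_norm)
  qed (use \<open>a \<le> b\<close> that in auto)
qed

lemma bounded_bilinear_matrix_mult:
  "bounded_bilinear ((**) :: real^'n^'k \<Rightarrow> real^'m^'n \<Rightarrow> real^'m^'k)"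
  unfolding bilinear_conv_bounded_bilinear[symmetric] bilinear_def
  by (auto simp: linear_iff vec_eq_iff matrix_matrix_mult_def sum.distrib sum_distrib_left algebra_simps)

lemma bounded_bilinear_matrix_vector_mult:
  "bounded_bilinear ((*v) :: real^'n^'k \<Rightarrow> real^'n \<Rightarrow> real^'k)"
  unfolding bilinear_conv_bounded_bilinear[symmetric] bilinear_def
  by (auto simp: linear_iff vec_eq_iff matrix_vector_mult_def sum.distrib sum_distrib_left algebra_simps)

text \<open>
  The inverse \<open>V\<close> of \<open>W\<close> is found as the solution of the adjoint equation \<open>V' = - V ** A\<close>, because
  then \<open>V ** W\<close> has derivative zero. This yields invertibility of \<open>W\<close> and continuity of its inverse
  without determinants.
\<close>

lemma fundamental_matrix:
  fixes A :: "real \<Rightarrow> real^'m^'m"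
  assumes A: "continuous_on {a..b} A" and "a \<le> b"
  obtains W V where "solves_ivp (\<lambda>t. (**) (A t)) a (mat 1) {a..b} W"
    "continuous_on {a..b} V" "V a = mat 1" "\<And>t. t \<in> {a..b} \<Longrightarrow> W t ** V t = mat 1"
proof -
  note bb = bounded_bilinear_matrix_mult
  obtain W where W: "solves_ivp (\<lambda>t. (**) (A t)) a (mat 1) {a..b} W"
    using linear_ivp_solvable[OF bb A \<open>a \<le> b\<close>] by blast
  have "continuous_on {a..b} (\<lambda>t. - A t)" using A by (rule continuous_on_minus)
  then obtain V where V: "solves_ivp (\<lambda>t M. M ** (- A t)) a (mat 1) {a..b} V"
    using linear_ivp_solvable[OF bounded_bilinear.flip[OF bb] _ \<open>a \<le> b\<close>] by blast
  have VW: "((\<lambda>t. V t ** W t) has_vector_derivative 0) (at t within {a..b})" if t: "t \<in> {a..b}" for t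
  proof -
    have "((\<lambda>t. V t ** W t) has_vector_derivative V t ** (A t ** W t) + (V t ** (- A t)) ** W t) (at t within {a..b})"
      using W V t by (intro bounded_bilinear.has_vector_derivative[OF bb]) (auto simp: solves_ivp_def)
    moreover have "V t ** (A t ** W t) + (V t ** (- A t)) ** W t = 0"
      by (simp add: matrix_mul_assoc bounded_bilinear.minus_left[OF bb] bounded_bilinear.minus_right[OF bb])
    ultimately show ?thesis by simp
  qed
  have "\<exists>c. \<forall>t\<in>{a..b}. V t ** W t = c"
    using VW by (intro has_derivative_zero_constant) (auto simp: has_vector_derivative_def)
  then obtain c where c: "\<forall>t\<in>{a..b}. V t ** W t = c" ..
  have "V a ** W a = mat 1" using V W by (simp add: solves_ivp_def)
  then have "V t ** W t = mat 1" if "t \<in> {a..b}" for t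
    using c that \<open>a \<le> b\<close> by auto
  then have "W t ** V t = mat 1" if "t \<in> {a..b}" for t
    using that by (simp add: matrix_left_right_inverse)
  moreover have "V a = mat 1" using V by (simp add: solves_ivp_def)
  ultimately show thesis by (intro that[OF W solves_ivp_continuous_on[OF V]]) auto
qed

text \<open>
  Left multiplication by \<open>A t\<close> commutes with right multiplication by a constant. Taking \<open>C\<close> to be the
  inverse of \<open>W s\<close>, the first part restarts the fundamental solution at time \<open>s\<close>.
\<close>

lemma solves_ivp_mult_right:
  fixes W :: "real \<Rightarrow> real^'m^'m"
  assumes W: "solves_ivp (\<lambda>t. (**) (A t)) a M S W"
  shows "W s ** C = N \<Longrightarrow> solves_ivp (\<lambda>t. (**) (A t)) s N S (\<lambda>t. W t ** C)"
    and "solves_ivp (\<lambda>t. (*v) (A t)) a (M *v h) S (\<lambda>t. W t *v h)"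
proof -
  have C: "bounded_linear (\<lambda>W :: real^'m^'m. W ** C)"
    by (rule bounded_bilinear.bounded_linear_left[OF bounded_bilinear_matrix_mult])
  have h: "bounded_linear (\<lambda>W :: real^'m^'m. W *v h)"
    by (rule bounded_bilinear.bounded_linear_left[OF bounded_bilinear_matrix_vector_mult])
  show "W s ** C = N \<Longrightarrow> solves_ivp (\<lambda>t. (**) (A t)) s N S (\<lambda>t. W t ** C)"
    using W bounded_linear.has_vector_derivative[OF C] by (auto simp: solves_ivp_def matrix_mul_assoc)
  show "solves_ivp (\<lambda>t. (*v) (A t)) a (M *v h) S (\<lambda>t. W t *v h)"
    using W bounded_linear.has_vector_derivative[OF h]
    by (auto simp: solves_ivp_def matrix_vector_mul_assoc)
qed

section \<open>Smooth right-hand sides with a parameter\<close>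

text \<open>
  Continuity of all directional derivatives is continuity of the derivative in operator norm, as the
  domain is finite-dimensional.
\<close>

lemma C_infinity_imp_C1:
  fixes g :: "'a::euclidean_space \<Rightarrow> 'b::real_normed_vector"
  assumes "C_infinity g"
  obtains g' :: "'a \<Rightarrow> 'a \<Rightarrow>\<^sub>L 'b" where "\<And>x. (g has_derivative g' x) (at x)" "continuous_on UNIV g'"
proof -
  define g' where "g' x = Blinfun (frechet_derivative g (at x))" for x
  have "Ck (Suc 0) g" using assms unfolding C_infinity_def by blast
  then have diff: "g differentiable (at x)" 
    and cont: "continuous_on UNIV (\<lambda>x. frechet_derivative g (at x) v)" for x v by auto
  have D: "(g has_derivative frechet_derivative g (at x)) (at x)" for x
    using diff frechet_derivative_works by blast
  then have apply_g': "blinfun_apply (g' x) = frechet_derivative g (at x)" for x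
    unfolding g'_def by (intro bounded_linear_Blinfun_apply has_derivative_bounded_linear)
  show thesis
  proof (rule that)
    show "(g has_derivative g' x) (at x)" for x using D by (simp add: apply_g')
    show "continuous_on UNIV g'"
      using cont by (intro continuous_on_blinfun_componentwise) (simp add: apply_g')
  qed
qed

lemma F1_F2_has_derivative:
  assumes D: "((\<lambda>(z, w). f z w) has_derivative D) (at (z, w))"
  shows "F1 f z w = matrix (\<lambda>h. D (h, 0))" "F2 f z w = matrix (\<lambda>k. D (0, k))"
    and "D (h, k) = F1 f z w *v h + F2 f z w *v k"
proof -
  have "((\<lambda>z'. (z', w)) has_derivative (\<lambda>h. (h, 0))) (at z)"
    "((\<lambda>w'. (z, w')) has_derivative (\<lambda>k. (0, k))) (at w)"
    by (auto intro!: derivative_eq_intros)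
  from this[THEN has_derivative_compose, OF D]
  have d: "((\<lambda>z'. f z' w) has_derivative (\<lambda>h. D (h, 0))) (at z)"
    "((\<lambda>w'. f z w') has_derivative (\<lambda>k. D (0, k))) (at w)" by auto
  show eq: "F1 f z w = matrix (\<lambda>h. D (h, 0))" "F2 f z w = matrix (\<lambda>k. D (0, k))"
    unfolding F1_def F2_def jacobian_def using d[THEN frechet_derivative_at] by simp_all
  have "F1 f z w *v h = D (h, 0)" "F2 f z w *v k = D (0, k)"
    unfolding eq using d[THEN has_derivative_linear] by (simp_all add: matrix_works)
  moreover have "D (h, k) = D (h, 0) + D (0, k)"
    using linear_add[OF has_derivative_linear[OF D], of "(h, 0)" "(0, k)"] by simp
  ultimately show "D (h, k) = F1 f z w *v h + F2 f z w *v k" by simp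
qed

lemma continuous_on_F1_F2:
  assumes D: "\<And>p. ((\<lambda>(z, w). f z w) has_derivative blinfun_apply (f' p)) (at p)"
    and f': "continuous_on UNIV f'" and u: "continuous_on S u"
  shows "continuous_on S (\<lambda>t. F1 f (u t) \<phi>)" "continuous_on S (\<lambda>t. F2 f (u t) \<phi>)"
proof -
  have "continuous_on S (\<lambda>t. f' (u t, \<phi>))"
    by (intro continuous_on_compose2[OF f'] continuous_intros u) auto
  then show "continuous_on S (\<lambda>t. F1 f (u t) \<phi>)" "continuous_on S (\<lambda>t. F2 f (u t) \<phi>)"
    unfolding F1_F2_has_derivative(1,2)[OF D] matrix_def by (auto intro!: continuous_intros)
qed

lemma lipschitz_on_balls_section:
  assumes "lipschitz_on_balls (\<lambda>(z, w). f z w)"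
  shows "lipschitz_on_balls (\<lambda>z. f z \<phi>)"
  unfolding lipschitz_on_balls_def
proof
  fix R
  obtain L where L: "L-lipschitz_on (cball 0 (R + norm \<phi>)) (\<lambda>(z, w). f z w)"
    using assms unfolding lipschitz_on_balls_def by blast
  have "dist (f z \<phi>) (f z' \<phi>) \<le> L * dist z z'" if "z \<in> cball 0 R" "z' \<in> cball 0 R" for z z'
  proof -
    have "(z, \<phi>) \<in> cball 0 (R + norm \<phi>)" "(z', \<phi>) \<in> cball 0 (R + norm \<phi>)"
      using that norm_Pair_le[of z \<phi>] norm_Pair_le[of z' \<phi>] by auto
    then show ?thesis using lipschitz_onD[OF L, of "(z, \<phi>)" "(z', \<phi>)"] by (simp add: dist_Pair_Pair)
  qed
  then show "\<exists>L. L-lipschitz_on (cball 0 R) (\<lambda>z. f z \<phi>)"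
    using lipschitz_on_nonneg[OF L] by (intro exI[of _ L] lipschitz_onI) auto
qed

lemma local_sol_eqI:
  assumes "lipschitz_on_balls (\<lambda>z. f z \<phi>)" "solves_ivp (\<lambda>_ z. f z \<phi>) \<xi> \<eta> S x" "closed_segment \<xi> t \<subseteq> S"
  shows "local_sol f t \<xi> \<eta> \<phi> = x t"
  unfolding local_sol_def
  by (rule ivp_value_autonomous[OF assms(1) solves_ivp_subset[OF assms(2,3)]])

section \<open>Sensitivities of the local solution\<close>

text \<open>
  As the equation is autonomous, the solution started at \<open>\<xi>'\<close> is a time shift of the one started at
  \<open>\<xi>\<close>, hence its value at \<open>t\<close> is that of \<open>u\<close> at time \<open>t + \<xi> - \<xi>'\<close>. For \<open>t\<close> at an end point of the
  interval this time can lie outside \<open>{\<xi>..T}\<close>, so the solution has to be extended in both directions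
  to obtain a two-sided derivative.
\<close>

lemma local_sol_has_start_derivative:
  assumes lip: "lipschitz_on_balls (\<lambda>z. f z \<phi>)"
    and u: "solves_ivp (\<lambda>_ z. f z \<phi>) \<xi> \<eta> {\<xi>..T} u" and t: "t \<in> {\<xi>..T}"
  shows "((\<lambda>\<xi>'. local_sol f t \<xi>' \<eta> \<phi>) has_vector_derivative - f (u t) \<phi>) (at \<xi>)"
proof -
  have "\<xi> \<le> T" using t by simp
  obtain \<delta> v where \<delta>: "0 < \<delta>" and v: "solves_ivp (\<lambda>_ z. f z \<phi>) \<xi> \<eta> {\<xi> - \<delta>..T + \<delta>} v"
    and vu: "\<And>t. t \<in> {\<xi>..T} \<Longrightarrow> v t = u t"
    using solution_extends[OF lip u \<open>\<xi> \<le> T\<close>] by blast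
  have eq: "local_sol f t \<xi>' \<eta> \<phi> = v (t + \<xi> - \<xi>')" if \<xi>': "\<xi>' \<in> ball \<xi> \<delta>" for \<xi>'
  proof (rule local_sol_eqI[where f = f and \<phi> = \<phi>, OF lip, where x = "\<lambda>\<tau>. v (\<tau> + \<xi> - \<xi>')"])
    let ?I = "closed_segment \<xi>' t" and ?s = "\<lambda>\<tau>. \<tau> + \<xi> - \<xi>'"
    have sub: "?s ` ?I \<subseteq> {\<xi> - \<delta>..T + \<delta>}"
      using \<xi>' t by (auto simp: closed_segment_eq_real_ivl dist_real_def split: if_splits)
    show "solves_ivp (\<lambda>_ z. f z \<phi>) \<xi>' \<eta> ?I (\<lambda>\<tau>. v (\<tau> + \<xi> - \<xi>'))"
      unfolding solves_ivp_def
    proof (intro conjI ballI)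
      show "v (\<xi>' + \<xi> - \<xi>') = \<eta>" using v by (simp add: solves_ivp_def)
      fix \<tau> assume \<tau>: "\<tau> \<in> ?I"
      have "((v \<circ> ?s) has_vector_derivative 1 *\<^sub>R f (v (?s \<tau>)) \<phi>) (at \<tau> within ?I)"
      proof (rule vector_diff_chain_within)
        show "(?s has_vector_derivative 1) (at \<tau> within ?I)" by (auto intro!: derivative_eq_intros)
        show "(v has_vector_derivative f (v (?s \<tau>)) \<phi>) (at (?s \<tau>) within ?s ` ?I)"
          using solves_ivp_subset[OF v sub] \<tau> by (simp add: solves_ivp_def)
      qed
      then show "((\<lambda>\<tau>. v (?s \<tau>)) has_vector_derivative f (v (?s \<tau>)) \<phi>) (at \<tau> within ?I)"
        by (simp add: o_def)
    qed
  qed simp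
  have "(v has_vector_derivative f (v t) \<phi>) (at t)"
  proof -
    have "(v has_vector_derivative f (v t) \<phi>) (at t within {\<xi> - \<delta>..T + \<delta>})"
      using v t \<delta> by (simp add: solves_ivp_def)
    then show ?thesis using t \<delta> by (simp add: at_within_Icc_at)
  qed
  then have dv: "(v has_vector_derivative f (u t) \<phi>) (at (t + \<xi> - \<xi>))" using vu[OF t] by simp
  have "((\<lambda>\<xi>'. t + \<xi> - \<xi>') has_vector_derivative - 1) (at \<xi>)" by (auto intro!: derivative_eq_intros)
  from vector_diff_chain_at[OF this dv]
  have "((\<lambda>\<xi>'. v (t + \<xi> - \<xi>')) has_vector_derivative - f (u t) \<phi>) (at \<xi>)" by (simp add: o_def)
  then show ?thesis
    by (rule has_vector_derivative_transform_within_open[OF _ open_ball[of \<xi> \<delta>]])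
      (use \<delta> eq in auto)
qed

text \<open>
  Adjoining the parameter to the state as a component with zero velocity turns dependence on
  \<open>(\<eta>, \<phi>)\<close> into dependence on the initial value of the autonomous system with right-hand side
  \<open>F (z, w) = (f z w, 0)\<close>. Its linearized equation is the variational equation for \<open>D\<close>, forced by
  \<open>F2\<close> applied to the perturbation \<open>k\<close> of the parameter.
\<close>

lemma local_sol_has_joint_derivative:
  fixes f :: "real^'m \<Rightarrow> real^'m \<Rightarrow> real^'m" and f' :: "(real^'m) \<times> (real^'m) \<Rightarrow> ((real^'m) \<times> (real^'m)) \<Rightarrow>\<^sub>L (real^'m)"
  assumes f: "\<And>p. ((\<lambda>(z, w). f z w) has_derivative f' p) (at p)" and f': "continuous_on UNIV f'"
    and u: "solves_ivp (\<lambda>_ z. f z \<phi>) \<xi> \<eta> {\<xi>..T} u"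
    and D: "\<And>h k. solves_ivp (\<lambda>s x. F1 f (u s) \<phi> *v x + F2 f (u s) \<phi> *v k) \<xi> h {\<xi>..T} (\<lambda>s. D s h k)"
    and lin: "bounded_linear (\<lambda>(h, k). D t h k)" and t: "t \<in> {\<xi>..T}"
  shows "((\<lambda>(\<eta>', \<phi>'). local_sol f t \<xi> \<eta>' \<phi>') has_derivative (\<lambda>(h, k). D t h k)) (at (\<eta>, \<phi>))"
proof -
  define F where "F p = (f (fst p) (snd p), 0 :: real^'m)" for p
  define F' where "F' p = Blinfun (\<lambda>h. (f' p h, 0 :: real^'m))" for p
  have F'_apply: "blinfun_apply (F' p) = (\<lambda>h. (f' p h, 0))" for p
    unfolding F'_def
    by (intro bounded_linear_Blinfun_apply bounded_linear_Pair blinfun.bounded_linear_right bounded_linear_zero)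
  have F: "(F has_derivative F' p) (at p)" for p
    unfolding F_def F'_apply using f[of p] by (auto simp: case_prod_unfold intro!: has_derivative_Pair)
  have F': "continuous_on UNIV F'"
    by (rule continuous_on_blinfun_componentwise) (auto simp: F'_apply intro!: continuous_intros f')
  have U: "solves_ivp (\<lambda>_. F) \<xi> (\<eta>, \<phi>) {\<xi>..T} (\<lambda>s. (u s, \<phi>))"
    using u by (auto simp: solves_ivp_def F_def intro!: has_vector_derivative_Pair)
  define E where "E s p = (case p of (h, k) \<Rightarrow> (D s h k, k))" for s p
  have E: "solves_ivp (\<lambda>s. F' (u s, \<phi>)) \<xi> p {\<xi>..T} (\<lambda>s. E s p)" for p
  proof (cases p)
    case (Pair h k)
    note Dhk = D[where h = h and k = k, unfolded solves_ivp_def]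
    show ?thesis
      unfolding solves_ivp_def Pair E_def F'_apply prod.case F1_F2_has_derivative(3)[OF f]
      using Dhk by (intro conjI ballI has_vector_derivative_Pair has_vector_derivative_const) auto
  qed
  have E_lin: "bounded_linear (E t)"
    using bounded_linear_Pair[OF lin bounded_linear_snd] by (simp add: E_def[abs_def] case_prod_unfold)
  have deriv: "((\<lambda>p. fst (ivp_value (\<lambda>_. F) \<xi> p t)) has_derivative (\<lambda>h. fst (E t h))) (at (\<eta>, \<phi>))"
    using flow_has_derivative[OF F F' U E E_lin t] by (rule has_derivative_fst)
  have lipF: "lipschitz_on_balls F" by (rule C1_lipschitz_on_balls[OF F F'])
  have lip: "lipschitz_on_balls (\<lambda>z. f z w)" for w
    by (rule lipschitz_on_balls_section[OF C1_lipschitz_on_balls[OF f f']])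
  have seg: "closed_segment \<xi> t \<subseteq> {\<xi>..T}" using t by (auto simp: closed_segment_eq_real_ivl)
  have "\<xi> \<le> T" using t by simp
  then obtain \<delta> where \<delta>: "0 < \<delta>"
    and near: "\<And>p. norm (p - (\<eta>, \<phi>)) < \<delta> \<Longrightarrow> \<exists>x. solves_ivp (\<lambda>_. F) \<xi> p {\<xi>..T} x"
    using nearby_solutions[OF lipF U] by metis
  have eq: "fst (ivp_value (\<lambda>_. F) \<xi> p t) = (case p of (\<eta>', \<phi>') \<Rightarrow> local_sol f t \<xi> \<eta>' \<phi>')"
    if "p \<in> ball (\<eta>, \<phi>) \<delta>" for p
  proof -
    have "norm (p - (\<eta>, \<phi>)) < \<delta>" using that by (simp add: dist_norm norm_minus_commute)
    then obtain x where x: "solves_ivp (\<lambda>_. F) \<xi> p {\<xi>..T} x" using near by blast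
    have dx: "(x has_vector_derivative F (x s)) (at s within {\<xi>..T})" if "s \<in> {\<xi>..T}" for s
      using x that by (simp add: solves_ivp_def)
    \<comment> \<open>The adjoined component is constant, hence the first component solves the equation with parameter \<open>snd p\<close>.\<close>
    have dsnd: "((\<lambda>s. snd (x s)) has_vector_derivative 0) (at s within {\<xi>..T})" if "s \<in> {\<xi>..T}" for s
      using bounded_linear.has_vector_derivative[OF bounded_linear_snd dx[OF that]] by (simp add: F_def)
    have "\<exists>c. \<forall>s\<in>{\<xi>..T}. snd (x s) = c"
      using dsnd by (intro has_derivative_zero_constant) (auto simp: has_vector_derivative_def)
    then obtain c where "\<forall>s\<in>{\<xi>..T}. snd (x s) = c" ..
    moreover have "x \<xi> = p" using x by (simp add: solves_ivp_def)
    ultimately have snd_x: "snd (x s) = snd p" if "s \<in> {\<xi>..T}" for s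
      using that \<open>\<xi> \<le> T\<close> by auto
    have "((\<lambda>s. fst (x s)) has_vector_derivative f (fst (x s)) (snd p)) (at s within {\<xi>..T})"
      if "s \<in> {\<xi>..T}" for s
      using bounded_linear.has_vector_derivative[OF bounded_linear_fst dx[OF that]] snd_x[OF that]
      by (simp add: F_def)
    then have "solves_ivp (\<lambda>_ z. f z (snd p)) \<xi> (fst p) {\<xi>..T} (\<lambda>s. fst (x s))"
      using \<open>x \<xi> = p\<close> by (simp add: solves_ivp_def)
    then have "local_sol f t \<xi> (fst p) (snd p) = fst (x t)" using seg by (rule local_sol_eqI[where f = f, OF lip])
    moreover have "ivp_value (\<lambda>_. F) \<xi> p t = x t"
      using seg by (intro ivp_value_autonomous[OF lipF] solves_ivp_subset[OF x])
    ultimately show ?thesis by (simp add: case_prod_unfold)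
  qed
  have "((\<lambda>(\<eta>', \<phi>'). local_sol f t \<xi> \<eta>' \<phi>') has_derivative (\<lambda>h. fst (E t h))) (at (\<eta>, \<phi>))"
    by (rule has_derivative_transform_within_open[OF deriv open_ball[of "(\<eta>, \<phi>)" \<delta>]]) (use \<delta> eq in auto)
  then show ?thesis by (simp add: E_def case_prod_unfold)
qed

theorem theorem1:
  fixes f :: "real^'m \<Rightarrow> real^'m \<Rightarrow> real^'m"
    and y :: "real \<Rightarrow> real \<Rightarrow> real^'m \<Rightarrow> real^'m \<Rightarrow> real^'m"
    and \<Phi> :: "real \<Rightarrow> real \<Rightarrow> real^'m^'m"
    and \<eta> \<phi> :: "real^'m" and \<xi> T t :: real
  assumes smooth: "C_infinity (\<lambda>(z, w). f z w)"
    and \<xi>: "0 \<le> \<xi>" "\<xi> < 1"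
    and T: "\<xi> < T" "T < 1"
    and exists_sol: "\<exists>u. solves_ivp (\<lambda>_ x. f x \<phi>) \<xi> \<eta> {\<xi>..T} u"
    and t: "t \<in> {\<xi>..T}"
  defines "y \<equiv> local_sol f"
  defines "\<Phi> \<equiv> (\<lambda>t s. Phi f t s \<phi> (\<lambda>\<tau>. y \<tau> \<xi> \<eta> \<phi>))"
  shows "(\<forall>s\<in>{\<xi>..T}. solves_ivp (variational_rhs f \<phi> (\<lambda>\<tau>. y \<tau> \<xi> \<eta> \<phi>)) s (mat 1) {\<xi>..T} (\<lambda>\<tau>. \<Phi> \<tau> s)) \<and>
    ((\<lambda>\<tau>. y \<tau> \<xi> \<eta> \<phi>) has_vector_derivative f (y t \<xi> \<eta> \<phi>) \<phi>) (at t within {\<xi>..T}) \<and>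
    ((\<lambda>\<eta>'. y t \<xi> \<eta>' \<phi>) has_derivative (\<lambda>h. \<Phi> t \<xi> *v h)) (at \<eta>) \<and>
    ((\<lambda>\<xi>'. y t \<xi>' \<eta> \<phi>) has_vector_derivative - (\<Phi> t \<xi> *v f \<eta> \<phi>)) (at \<xi>) \<and>
    (\<lambda>s. \<Phi> t s ** F2 f (y s \<xi> \<eta> \<phi>) \<phi>) integrable_on {\<xi>..t} \<and>
    ((\<lambda>\<phi>'. y t \<xi> \<eta> \<phi>') has_derivative
       (\<lambda>h. integral {\<xi>..t} (\<lambda>s. \<Phi> t s ** F2 f (y s \<xi> \<eta> \<phi>) \<phi>) *v h)) (at \<phi>)"
proof -
  note mult_bb = bounded_bilinear_matrix_mult
  obtain f' :: "(real^'m) \<times> (real^'m) \<Rightarrow> ((real^'m) \<times> (real^'m)) \<Rightarrow>\<^sub>L (real^'m)"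
    where f: "\<And>p. ((\<lambda>(z, w). f z w) has_derivative f' p) (at p)" and f': "continuous_on UNIV f'"
    using C_infinity_imp_C1[OF smooth] by blast
  have lip: "lipschitz_on_balls (\<lambda>z. f z \<phi>)"
    by (rule lipschitz_on_balls_section[OF C1_lipschitz_on_balls[OF f f']])
  obtain u where u: "solves_ivp (\<lambda>_ z. f z \<phi>) \<xi> \<eta> {\<xi>..T} u" using exists_sol ..
  have "\<xi> \<le> T" using T by simp
  have y_eq: "y s \<xi> \<eta> \<phi> = u s" if "s \<in> {\<xi>..T}" for s
    unfolding y_def using that
    by (intro local_sol_eqI[where f = f and \<phi> = \<phi>, OF lip u]) (auto simp: closed_segment_eq_real_ivl)
  have u_start: "u \<xi> = \<eta>" using u by (simp add: solves_ivp_def)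
  have du: "(u has_vector_derivative f (u s) \<phi>) (at s within {\<xi>..T})" if "s \<in> {\<xi>..T}" for s
    using u that by (simp add: solves_ivp_def)

  define A B where "A s = F1 f (u s) \<phi>" and "B s = F2 f (u s) \<phi>" for s
  have A: "continuous_on {\<xi>..T} A" and B: "continuous_on {\<xi>..T} B"
    unfolding A_def B_def using continuous_on_F1_F2[OF f f' solves_ivp_continuous_on[OF u]] by auto
  obtain W V where W: "solves_ivp (\<lambda>s. (**) (A s)) \<xi> (mat 1) {\<xi>..T} W"
    and V: "continuous_on {\<xi>..T} V" "V \<xi> = mat 1" and WV: "\<And>s. s \<in> {\<xi>..T} \<Longrightarrow> W s ** V s = mat 1"
    using fundamental_matrix[OF A \<open>\<xi> \<le> T\<close>] by metis
  have WV_solves: "solves_ivp (\<lambda>\<tau>. (**) (A \<tau>)) s (mat 1) {\<xi>..T} (\<lambda>\<tau>. W \<tau> ** V s)"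
    if "s \<in> {\<xi>..T}" for s
    by (rule solves_ivp_mult_right(1)[OF W WV[OF that]])
  have rhs_eq: "variational_rhs f \<phi> (\<lambda>\<tau>. y \<tau> \<xi> \<eta> \<phi>) \<tau> = (**) (A \<tau>)" if "\<tau> \<in> {\<xi>..T}" for \<tau>
    using that by (simp add: fun_eq_iff variational_rhs_def A_def y_eq)
  have \<Phi>_eq: "\<Phi> \<tau> s = W \<tau> ** V s" if "\<tau> \<in> {\<xi>..T}" "s \<in> {\<xi>..T}" for \<tau> s
    unfolding \<Phi>_def Phi_def
  proof (rule ivp_value_eqI)
    have sub: "closed_segment s \<tau> \<subseteq> {\<xi>..T}" using that by (auto simp: closed_segment_eq_real_ivl)
    show "solves_ivp (variational_rhs f \<phi> (\<lambda>\<tau>. y \<tau> \<xi> \<eta> \<phi>)) s (mat 1) (closed_segment s \<tau>) (\<lambda>\<tau>. W \<tau> ** V s)"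
      using sub rhs_eq by (intro solves_ivp_cong[OF solves_ivp_subset[OF WV_solves[OF that(2)] sub]]) auto
    obtain L where L: "\<And>r (M::real^'m^'m) N. r \<in> {\<xi>..T} \<Longrightarrow> norm (A r ** M - A r ** N) \<le> L * norm (M - N)"
      using linear_rhs_lipschitz[OF mult_bb compact_Icc A] by metis
    show "\<exists>L. \<forall>r\<in>closed_segment s \<tau>.
        norm (variational_rhs f \<phi> (\<lambda>\<tau>. y \<tau> \<xi> \<eta> \<phi>) r (W r ** V s) - variational_rhs f \<phi> (\<lambda>\<tau>. y \<tau> \<xi> \<eta> \<phi>) r (Z r))
        \<le> L * norm (W r ** V s - Z r)" for Z
    proof (intro exI ballI)
      fix r assume "r \<in> closed_segment s \<tau>"
      then have r: "r \<in> {\<xi>..T}" using sub by blast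
      show "norm (variational_rhs f \<phi> (\<lambda>\<tau>. y \<tau> \<xi> \<eta> \<phi>) r (W r ** V s) - variational_rhs f \<phi> (\<lambda>\<tau>. y \<tau> \<xi> \<eta> \<phi>) r (Z r))
        \<le> L * norm (W r ** V s - Z r)"
        unfolding rhs_eq[OF r] by (rule L[OF r])
    qed
  qed
  then have \<Phi>_start: "\<Phi> t \<xi> = W t" using t V by simp

  have variational: "solves_ivp (variational_rhs f \<phi> (\<lambda>\<tau>. y \<tau> \<xi> \<eta> \<phi>)) s (mat 1) {\<xi>..T} (\<lambda>\<tau>. \<Phi> \<tau> s)"
    if s: "s \<in> {\<xi>..T}" for s
    unfolding solves_ivp_def
  proof (intro conjI ballI)
    show "\<Phi> s s = mat 1" using s WV \<Phi>_eq by simp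
    fix \<tau> assume \<tau>: "\<tau> \<in> {\<xi>..T}"
    have "((\<lambda>\<tau>. W \<tau> ** V s) has_vector_derivative A \<tau> ** (W \<tau> ** V s)) (at \<tau> within {\<xi>..T})"
      using WV_solves[OF s] \<tau> by (simp add: solves_ivp_def)
    then have "((\<lambda>\<tau>. \<Phi> \<tau> s) has_vector_derivative A \<tau> ** (W \<tau> ** V s)) (at \<tau> within {\<xi>..T})"
      by (rule has_vector_derivative_transform[OF \<tau>, rotated]) (rule \<Phi>_eq[OF _ s])
    then show "((\<lambda>\<tau>. \<Phi> \<tau> s) has_vector_derivative variational_rhs f \<phi> (\<lambda>\<tau>. y \<tau> \<xi> \<eta> \<phi>) \<tau> (\<Phi> \<tau> s)) (at \<tau> within {\<xi>..T})"
      by (simp add: rhs_eq[OF \<tau>] \<Phi>_eq[OF \<tau> s])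
  qed

  have time: "((\<lambda>\<tau>. y \<tau> \<xi> \<eta> \<phi>) has_vector_derivative f (y t \<xi> \<eta> \<phi>) \<phi>) (at t within {\<xi>..T})"
    unfolding y_eq[OF t] by (rule has_vector_derivative_transform[OF t _ du[OF t]]) (rule y_eq)

  \<comment> \<open>The velocity along a trajectory obeys the variational equation, as differentiating the equation in time shows.\<close>
  have velocity_solves: "solves_ivp (\<lambda>s. (*v) (A s)) \<xi> (f \<eta> \<phi>) {\<xi>..T} (\<lambda>s. f (u s) \<phi>)"
    unfolding solves_ivp_def
  proof (intro conjI ballI)
    fix s assume s: "s \<in> {\<xi>..T}"
    have "((\<lambda>s. (u s, \<phi>)) has_derivative (\<lambda>r. (r *\<^sub>R f (u s) \<phi>, 0))) (at s within {\<xi>..T})"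
      using du[OF s] unfolding has_vector_derivative_def by (intro has_derivative_Pair has_derivative_const)
    from has_derivative_compose[OF this f]
    have "((\<lambda>s. f (u s) \<phi>) has_derivative (\<lambda>r. A s *v (r *\<^sub>R f (u s) \<phi>))) (at s within {\<xi>..T})"
      by (simp add: F1_F2_has_derivative(3)[OF f] A_def)
    then show "((\<lambda>s. f (u s) \<phi>) has_vector_derivative A s *v f (u s) \<phi>) (at s within {\<xi>..T})"
      by (simp add: has_vector_derivative_def matrix_vector_mult_scaleR)
  qed (simp add: u_start)
  have W_velocity_solves: "solves_ivp (\<lambda>s. (*v) (A s)) \<xi> (f \<eta> \<phi>) {\<xi>..T} (\<lambda>s. W s *v f \<eta> \<phi>)"
    using solves_ivp_mult_right(2)[OF W, of "f \<eta> \<phi>"] by simp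
  have seg: "closed_segment \<xi> t \<subseteq> {\<xi>..T}" using t by (auto simp: closed_segment_eq_real_ivl)
  have velocity: "f (u t) \<phi> = W t *v f \<eta> \<phi>"
    by (rule linear_ivp_unique[OF bounded_bilinear_matrix_vector_mult continuous_on_subset[OF A seg]
          solves_ivp_subset[OF velocity_solves seg] solves_ivp_subset[OF W_velocity_solves seg]])
  have start: "((\<lambda>\<xi>'. y t \<xi>' \<eta> \<phi>) has_vector_derivative - (\<Phi> t \<xi> *v f \<eta> \<phi>)) (at \<xi>)"
    using local_sol_has_start_derivative[where f = f and \<phi> = \<phi>, OF lip u t]
    by (simp add: y_def \<Phi>_start velocity)

  \<comment> \<open>Variation of constants: \<open>\<Psi>\<close> solves \<open>\<Psi>' = A \<Psi> + B\<close> with \<open>\<Psi> \<xi> = 0\<close>.\<close>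
  define \<Psi> where "\<Psi> s = W s ** integral {\<xi>..s} (\<lambda>r. V r ** B r)" for s
  have VB: "continuous_on {\<xi>..T} (\<lambda>r. V r ** B r)"
    by (rule bounded_bilinear.continuous_on[OF mult_bb V(1) B])
  have d\<Psi>: "(\<Psi> has_vector_derivative A s ** \<Psi> s + B s) (at s within {\<xi>..T})" if s: "s \<in> {\<xi>..T}" for s
  proof -
    have "(\<Psi> has_vector_derivative W s ** (V s ** B s) + (A s ** W s) ** integral {\<xi>..s} (\<lambda>r. V r ** B r)) (at s within {\<xi>..T})"
      unfolding \<Psi>_def using W s
      by (intro bounded_bilinear.has_vector_derivative[OF mult_bb] integral_has_vector_derivative[OF VB])
        (auto simp: solves_ivp_def)
    then show ?thesis by (simp add: \<Psi>_def matrix_mul_assoc WV[OF s] add.commute)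
  qed
  have joint: "((\<lambda>(\<eta>', \<phi>'). local_sol f t \<xi> \<eta>' \<phi>') has_derivative (\<lambda>(h, k). W t *v h + \<Psi> t *v k)) (at (\<eta>, \<phi>))"
  proof (rule local_sol_has_joint_derivative[OF f f' u _ _ t])
    fix h k
    show "solves_ivp (\<lambda>s x. F1 f (u s) \<phi> *v x + F2 f (u s) \<phi> *v k) \<xi> h {\<xi>..T} (\<lambda>s. W s *v h + \<Psi> s *v k)"
      unfolding solves_ivp_def
    proof (intro conjI ballI)
      show "W \<xi> *v h + \<Psi> \<xi> *v k = h" using W by (simp add: solves_ivp_def \<Psi>_def)
      fix s assume s: "s \<in> {\<xi>..T}"
      have bl: "bounded_linear (\<lambda>M :: real^'m^'m. M *v x)" for x
        by (rule bounded_bilinear.bounded_linear_left[OF bounded_bilinear_matrix_vector_mult])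
      have "(W has_vector_derivative A s ** W s) (at s within {\<xi>..T})" using W s by (simp add: solves_ivp_def)
      from has_vector_derivative_add[OF bounded_linear.has_vector_derivative[OF bl this]
          bounded_linear.has_vector_derivative[OF bl d\<Psi>[OF s]]]
      show "((\<lambda>s. W s *v h + \<Psi> s *v k) has_vector_derivative
          F1 f (u s) \<phi> *v (W s *v h + \<Psi> s *v k) + F2 f (u s) \<phi> *v k) (at s within {\<xi>..T})"
        by (simp add: A_def[symmetric] B_def[symmetric] matrix_vector_mul_assoc matrix_vector_right_distrib
            matrix_vector_mult_add_rdistrib add.assoc)
    qed
  next
    show "bounded_linear (\<lambda>(h, k). W t *v h + \<Psi> t *v k)"
      unfolding case_prod_unfold
      by (intro bounded_linear_add bounded_linear_compose[OF matrix_vector_mul_bounded_linear]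
          bounded_linear_fst bounded_linear_snd)
  qed

  have "((\<lambda>\<eta>'. (\<eta>', \<phi>)) has_derivative (\<lambda>h. (h, 0))) (at \<eta>)"
    by (intro has_derivative_Pair has_derivative_ident has_derivative_const)
  from has_derivative_compose[OF this joint]
  have initial: "((\<lambda>\<eta>'. y t \<xi> \<eta>' \<phi>) has_derivative (\<lambda>h. \<Phi> t \<xi> *v h)) (at \<eta>)"
    by (simp add: y_def \<Phi>_start)

  have "((\<lambda>\<phi>'. (\<eta>, \<phi>')) has_derivative (\<lambda>k. (0, k))) (at \<phi>)"
    by (intro has_derivative_Pair has_derivative_ident has_derivative_const)
  from has_derivative_compose[OF this joint]
  have param: "((\<lambda>\<phi>'. y t \<xi> \<eta> \<phi>') has_derivative (\<lambda>k. \<Psi> t *v k)) (at \<phi>)"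
    by (simp add: y_def)

  have kernel_eq: "\<Phi> t s ** F2 f (y s \<xi> \<eta> \<phi>) \<phi> = W t ** (V s ** B s)" if "s \<in> {\<xi>..t}" for s
    using that t by (simp add: \<Phi>_eq y_eq B_def matrix_mul_assoc)
  have "continuous_on {\<xi>..t} (\<lambda>r. V r ** B r)" using t by (intro continuous_on_subset[OF VB]) auto
  then have VB_int: "((\<lambda>r. V r ** B r) has_integral integral {\<xi>..t} (\<lambda>r. V r ** B r)) {\<xi>..t}"
    by (intro integrable_integral integrable_continuous_real)
  have "((\<lambda>s. W t ** (V s ** B s)) has_integral \<Psi> t) {\<xi>..t}"
    using has_integral_linear[OF VB_int bounded_bilinear.bounded_linear_right[OF mult_bb]]
    by (simp add: o_def \<Psi>_def)
  then have kernel: "((\<lambda>s. \<Phi> t s ** F2 f (y s \<xi> \<eta> \<phi>) \<phi>) has_integral \<Psi> t) {\<xi>..t}"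
    by (rule has_integral_eq[rotated]) (simp add: kernel_eq)
  show ?thesis
    using variational time initial start param kernel integral_unique[OF kernel]
    by (auto simp: has_integral_integrable)
qed

end
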